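(* Let $H$ be normalised (with $q\ge 2$ the smallest period). Then $$c>2A,\qquad\text{and}\qquad c^2\Big(\tfrac12+\ln\tfrac{c}{2A}\Big)>\tfrac1q\,\mathrm{Tr}\,L^2 .$$
   Context: Let $q\ge 2$ be an integer and let $(a_n)_{n\in\mathbb Z}$, $(b_n)_{n\in\mathbb Z}$ be real sequences with $a_n>0$, $a_{n+q}=a_n$, $b_{n+q}=b_n$ for all $n$, where $q$ is the smallest common period (there is no $1\le p<q$ with $a_{n+p}=a_n$ and $b_{n+p}=b_n$ for all $n$). $H$ is the bounded self-adjoint operator on $\ell^2(\mathbb Z)$ given by $(H\psi)_n=a_{n-1}\psi_{n-1}+b_n\psi_n+a_n\psi_{n+1}$. Set $A=(a_1a_2\cdots a_q)^{1/q}$. For $\lambda\in\mathbb C$ let $\phi(\lambda),\theta(\lambda)$ be the solutions of $a_{n-1}\psi_{n-1}+b_n\psi_n+a_n\psi_{n+1}=\lambda\psi_n$ ($n\in\mathbb Z$) with $\phi_0=0,\phi_1=1$ and $\theta_0=1,\theta_1=0$; the discriminant is the degree-$q$ polynomial $D(\lambda)=\phi_{q+1}(\lambda)+\theta_q(\lambda)$. The spectrum of $H$ is $\{\lambda\in\mathbb R:|D(\lambda)|\le 2\}$, a union of the $q$ bands $[\lambda^+_{m-1},\lambda^-_m]$, $m=1,\dots,q$, with $\lambda^+_0<\lambda^-_1\le\lambda^+_1<\lambda^-_2\le\dots\le\lambda^+_{q-1}<\lambda^-_q$, separated by the gaps $\gamma_m=(\lambda^-_m,\lambda^+_m)$, $m=1,\dots,q-1$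 (a gap is open if $\lambda^-_m<\lambda^+_m$). Let $c=(\lambda^-_q-\lambda^+_0)/2$ be half the width of the spectrum. $H$ is called normalised if $\lambda^+_0=-\lambda^-_q$ (so the spectrum lies in $[-c,c]$ with endpoints $\pm c$). The $q\times q$ matrix $L$ is defined by $L=\begin{pmatrix} b_1 & a_1+ia_2\\ a_1-ia_2 & b_2\end{pmatrix}$ if $q=2$, and for $q\ge 3$ by $L_{jj}=b_j$ ($1\le j\le q$), $L_{j,j+1}=L_{j+1,j}=a_j$ ($1\le j\le q-1$), $L_{1q}=ia_q$, $L_{q1}=-ia_q$, and all other entries $0$. *)

theory Defs
  imports Complex_Main
begin

text \<open>Solution of a_{m-1} psi_{m-1} + b_m psi_m + a_m psi_{m+1} = l psi_m
  with psi_0 = x0, psi_1 = x1, computed for indices m >= 0.\<close>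
fun jsol :: "(int \<Rightarrow> real) \<Rightarrow> (int \<Rightarrow> real) \<Rightarrow> real \<Rightarrow> real \<Rightarrow> real \<Rightarrow> nat \<Rightarrow> real" where
  "jsol a b l x0 x1 0 = x0"
| "jsol a b l x0 x1 (Suc 0) = x1"
| "jsol a b l x0 x1 (Suc (Suc n)) =
     ((l - b (int n + 1)) * jsol a b l x0 x1 (Suc n) - a (int n) * jsol a b l x0 x1 n) / a (int n + 1)"

definition phi :: "(int \<Rightarrow> real) \<Rightarrow> (int \<Rightarrow> real) \<Rightarrow> real \<Rightarrow> nat \<Rightarrow> real" where
  "phi a b l = jsol a b l 0 1"

definition theta :: "(int \<Rightarrow> real) \<Rightarrow> (int \<Rightarrow> real) \<Rightarrow> real \<Rightarrow> nat \<Rightarrow> real" where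
  "theta a b l = jsol a b l 1 0"

definition discr :: "(int \<Rightarrow> real) \<Rightarrow> (int \<Rightarrow> real) \<Rightarrow> nat \<Rightarrow> real \<Rightarrow> real" where
  "discr a b q l = phi a b l (q + 1) + theta a b l q"

text \<open>Spectrum of the periodic Jacobi operator: {l real. |D(l)| <= 2}.\<close>
definition jspec :: "(int \<Rightarrow> real) \<Rightarrow> (int \<Rightarrow> real) \<Rightarrow> nat \<Rightarrow> real set" where
  "jspec a b q = {l. \<bar>discr a b q l\<bar> \<le> 2}"

definition spec_bot :: "(int \<Rightarrow> real) \<Rightarrow> (int \<Rightarrow> real) \<Rightarrow> nat \<Rightarrow> real" where
  "spec_bot a b q = Inf (jspec a b q)"

definition spec_top :: "(int \<Rightarrow> real) \<Rightarrow> (int \<Rightarrow> real) \<Rightarrow> nat \<Rightarrow> real" where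
  "spec_top a b q = Sup (jspec a b q)"

definition half_width :: "(int \<Rightarrow> real) \<Rightarrow> (int \<Rightarrow> real) \<Rightarrow> nat \<Rightarrow> real" where
  "half_width a b q = (spec_top a b q - spec_bot a b q) / 2"

definition normalised :: "(int \<Rightarrow> real) \<Rightarrow> (int \<Rightarrow> real) \<Rightarrow> nat \<Rightarrow> bool" where
  "normalised a b q \<longleftrightarrow> spec_bot a b q = - spec_top a b q"

definition min_common_period :: "(int \<Rightarrow> real) \<Rightarrow> (int \<Rightarrow> real) \<Rightarrow> nat \<Rightarrow> bool" where
  "min_common_period a b q \<longleftrightarrow> q \<ge> 1 \<and>
     (\<forall>n. a (n + int q) = a n \<and> b (n + int q) = b n) \<and>
     (\<forall>p. 1 \<le> p \<and> p < q \<longrightarrow> \<not> (\<forall>n. a (n + int p) = a n \<and> b (n + int p) = b n))"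

definition geo_mean :: "(int \<Rightarrow> real) \<Rightarrow> nat \<Rightarrow> real" where
  "geo_mean a q = (\<Prod>j=1..q. a (int j)) powr (1 / real q)"

definition Lmat :: "(int \<Rightarrow> real) \<Rightarrow> (int \<Rightarrow> real) \<Rightarrow> nat \<Rightarrow> nat \<Rightarrow> nat \<Rightarrow> complex" where
  "Lmat a b q j k =
    (if q = 2 then
       (if j = 1 \<and> k = 1 then complex_of_real (b 1)
        else if j = 1 \<and> k = 2 then complex_of_real (a 1) + \<i> * complex_of_real (a 2)
        else if j = 2 \<and> k = 1 then complex_of_real (a 1) - \<i> * complex_of_real (a 2)
        else if j = 2 \<and> k = 2 then complex_of_real (b 2)
        else 0)
     else
       (if j = k then complex_of_real (b (int j))
        else if 1 \<le> j \<and> j \<le> q - 1 \<and> k = j + 1 then complex_of_real (a (int j))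
        else if 1 \<le> k \<and> k \<le> q - 1 \<and> j = k + 1 then complex_of_real (a (int k))
        else if j = 1 \<and> k = q then \<i> * complex_of_real (a (int q))
        else if j = q \<and> k = 1 then - \<i> * complex_of_real (a (int q))
        else 0))"

definition trace_L2 :: "(int \<Rightarrow> real) \<Rightarrow> (int \<Rightarrow> real) \<Rightarrow> nat \<Rightarrow> complex" where
  "trace_L2 a b q = (\<Sum>j=1..q. \<Sum>k=1..q. Lmat a b q j k * Lmat a b q k j)"

end

theory Submission
  imports Defs "HOL-Complex_Analysis.Complex_Analysis" "HOL-Computational_Algebra.Fundamental_Theorem_Algebra"
begin

text \<open>
  Put \<open>h = c / 2\<close> and \<open>l = h (z + 1 / z)\<close>, which maps the punctured unit disc to the complement of
  \<open>[-c, c]\<close>, a set on which \<open>D\<close> avoids \<open>[-2, 2]\<close>. Hence the outer root \<open>w\<close> of \<open>w + 1 / w = D(l)\<close>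
  is holomorphic there and \<open>u(z) = z^q w\<close> extends to a zero-free function on the disc. Its
  logarithm \<open>f = log u\<close> satisfies \<open>q ln |z| \<le> Re f \<le> M\<close>, and its Taylor coefficients are
  \<open>f_0 = q ln (h / A)\<close> and \<open>f_2 = q - Tr L^2 / (2 h^2)\<close>. Averaging \<open>Re f\<close> over circles against the weights
  \<open>1\<close> and \<open>1 + cos 2t\<close> gives \<open>f_0 \<ge> 0\<close> and \<open>2 f_0 + f_2 \<ge> 0\<close>; in the second case equality forces
  \<open>f_0 = 0\<close>, because \<open>Re f\<close> is bounded above. Finally \<open>f_0 = 0\<close> means \<open>c = 2 A\<close> and
  \<open>Tr L^2 \<le> 2 q A^2\<close>, so by AM-GM \<open>b = 0\<close> and \<open>a\<close> is constant, against the minimality of the period.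
\<close>

section \<open>Taylor coefficients of functions with bounded real part\<close>

text \<open>Cauchy's formula for the \<open>k\<close>-th derivative on the circle of radius
  \<open>r\<close>, written in the angle: the \<open>k\<close>-th Fourier coefficient of
  \<open>f\<close> on the circle is \<open>r ^ k\<close> times its Taylor coefficient.\<close>

lemma has_integral_Cauchy_coeff:
  fixes f :: "complex \<Rightarrow> complex"
  assumes f: "f holomorphic_on ball 0 1" and r: "0 < r" "r < 1"
  shows "((\<lambda>t. f (of_real r * cis t) * cis (- (real k * t))) has_integral
           2 * pi * of_real r ^ k * (deriv ^^ k) f 0 / fact k) {0..2 * pi}"
proof -
  have "cball 0 r \<subseteq> ball (0::complex) 1" "ball 0 r \<subseteq> ball (0::complex) 1"
    using r by auto
  then have "continuous_on (cball 0 r) f" "f holomorphic_on ball 0 r"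
    using f holomorphic_on_imp_continuous_on holomorphic_on_subset by blast+
  then have "((\<lambda>u. f u / (u - 0) ^ Suc k) has_contour_integral
      (2 * pi * \<i>) / fact k * (deriv ^^ k) f 0) (circlepath 0 r)"
    using r by (intro Cauchy_has_contour_integral_higher_derivative_circlepath) auto
  then have "((\<lambda>t. f (0 + of_real r * cis t) / (0 + of_real r * cis t - 0) ^ Suc k * of_real r * \<i> * cis t)
       has_integral (2 * pi * \<i>) / fact k * (deriv ^^ k) f 0) {0..2 * pi}"
    unfolding circlepath_def by (subst (asm) has_contour_integral_part_circlepath_iff) auto
  \<comment> \<open>The factor \<open>r ^ k / \<i>\<close> cancels the modulus of
    \<open>z ^ k\<close> and the \<open>\<i>\<close> of the path derivative.\<close>
  then have "((\<lambda>t. (of_real r ^ k / \<i>) * (f (0 + of_real r * cis t) / (0 + of_real r * cis t - 0) ^ Suc k * of_real r * \<i> * cis t))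
       has_integral (of_real r ^ k / \<i>) * ((2 * pi * \<i>) / fact k * (deriv ^^ k) f 0)) {0..2 * pi}"
    by (rule has_integral_mult_right)
  moreover have "(of_real r ^ k / \<i>) * (f (0 + of_real r * cis t) / (0 + of_real r * cis t - 0) ^ Suc k * of_real r * \<i> * cis t)
      = f (of_real r * cis t) * cis (- (real k * t))" for t
  proof -
    have "cis (- (real k * t)) = inverse (cis t ^ k)"
      by (simp only: Complex.DeMoivre cis_inverse)
    moreover have "cis t \<noteq> 0"
      by simp
    ultimately show ?thesis
      using r by (simp only: add_0_left diff_zero) (simp add: power_mult_distrib field_simps)
  qed
  moreover have "(of_real r ^ k / \<i>) * ((2 * pi * \<i>) / fact k * (deriv ^^ k) f 0)
      = 2 * pi * of_real r ^ k * (deriv ^^ k) f 0 / fact k"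
    by (simp add: field_simps)
  ultimately show ?thesis
    by simp
qed

text \<open>For \<open>k > 0\<close> the function \<open>z ^ k * f z\<close> vanishes at 0, and so
  does its mean over the circle.\<close>

lemma has_integral_Cauchy_negative_coeff:
  fixes f :: "complex \<Rightarrow> complex"
  assumes f: "f holomorphic_on ball 0 1" and r: "0 < r" "r < 1" and k: "k > 0"
  shows "((\<lambda>t. f (of_real r * cis t) * cis (real k * t)) has_integral 0) {0..2 * pi}"
proof -
  have "(\<lambda>z. z ^ k * f z) holomorphic_on ball 0 1"
    by (intro holomorphic_intros f)
  from has_integral_Cauchy_coeff[OF this r, of 0]
  have "((\<lambda>t. (of_real r ^ k) * (cis (real k * t) * f (of_real r * cis t))) has_integral 0) {0..2 * pi}"
    using k by (simp add: power_mult_distrib Complex.DeMoivre mult_ac power_0_left)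
  from has_integral_mult_right[OF this, of "inverse (of_real r ^ k)"]
  show ?thesis
    using r by (auto simp: field_simps elim!: has_integral_eq[rotated])
qed

text \<open>Dominated convergence: the powers tend to 0 except at the zeros of \<open>cos\<close>,
  which are finitely many in the interval. This drives the case of equality below.\<close>

lemma sin_even_power_integral_tendsto_0:
  "(\<lambda>n. integral {0..2 * pi} (\<lambda>t. (sin t ^ 2) ^ n)) \<longlonglongrightarrow> 0"
proof -
  let ?g = "\<lambda>t. if cos t = 0 then 1 else (0::real)"
  have "(\<lambda>n. integral {0..2 * pi} (\<lambda>t. (sin t ^ 2) ^ n)) \<longlonglongrightarrow> integral {0..2 * pi} ?g"
  proof (rule dominated_convergence(2)[where h = "\<lambda>_. 1"])
    fix n show "(\<lambda>t. (sin t ^ 2) ^ n) integrable_on {0..2 * pi}"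
      by (intro integrable_continuous_interval continuous_intros)
    fix t :: real
    have "sin t ^ 2 \<le> 1" by (simp add: abs_square_le_1)
    then show "norm ((sin t ^ 2) ^ n) \<le> 1"
      by (simp add: power_le_one)
  next
    fix t :: real
    show "(\<lambda>n. (sin t ^ 2) ^ n) \<longlonglongrightarrow> ?g t"
    proof (cases "cos t = 0")
      case True
      then have "sin t ^ 2 = 1" using sin_cos_squared_add[of t] by simp
      then show ?thesis using True by simp
    next
      case False
      then have "cos t ^ 2 > 0" by simp
      then have "sin t ^ 2 < 1" using sin_cos_squared_add[of t] by linarith
      then show ?thesis using False by (simp add: LIMSEQ_power_zero)
    qed
  qed auto
  moreover have "(?g has_integral 0) {0..2 * pi}"
  proof (rule has_integral_spike_finite[where f = "\<lambda>_. 0" and S = "{t \<in> {0..2*pi}. cos t = 0}"])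
    have "{t \<in> {0..2*pi}. cos t = 0} \<subseteq> {pi / 2, 3 * pi / 2}"
    proof
      fix t assume "t \<in> {t \<in> {0..2*pi}. cos t = 0}"
      then have t: "0 \<le> t" "t \<le> 2 * pi" "cos t = 0" by auto
      show "t \<in> {pi / 2, 3 * pi / 2}"
      proof (cases "t \<le> pi")
        case True
        then have "t = pi / 2"
          using t cos_inj_pi[of t "pi/2"] by auto
        then show ?thesis by simp
      next
        case False
        then have "2 * pi - t = pi / 2"
          using t cos_inj_pi[of "2 * pi - t" "pi/2"] by (auto simp: cos_diff)
        then show ?thesis by simp
      qed
    qed
    then show "finite {t \<in> {0..2*pi}. cos t = 0}"
      by (rule finite_subset) simp
  qed auto
  ultimately show ?thesis
    by (simp add: integral_unique)
qed

text \<open>On the circle of radius \<open>r\<close>, \<open>lower\<close> makes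
  \<open>Re f - q * ln r\<close> nonnegative. It is integrated against the nonnegative weights
  \<open>1\<close> and \<open>1 + cos (2 * t)\<close>, and as \<open>r\<close> tends to 1 the term
  \<open>q * ln r\<close> disappears. The bound \<open>M\<close> serves the case of
  equality.\<close>

lemma coefficient_bounds_of_bounded_Re:
  fixes f :: "complex \<Rightarrow> complex" and q M :: real
  assumes f: "f holomorphic_on ball 0 1"
    and lower: "\<And>z. \<lbrakk>norm z < 1; z \<noteq> 0\<rbrakk> \<Longrightarrow> q * ln (norm z) \<le> Re (f z)"
    and upper: "\<And>z. norm z < 1 \<Longrightarrow> Re (f z) \<le> M"
  defines "c0 \<equiv> Re (f 0)" and "c2 \<equiv> Re ((deriv ^^ 2) f 0) / 2"
  shows "0 \<le> c0" and "0 \<le> 2 * c0 + c2" and "2 * c0 + c2 = 0 \<Longrightarrow> c0 = 0"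
proof -
  have mean: "((\<lambda>t. Re (f (of_real r * cis t))) has_integral 2 * pi * c0) {0..2*pi}"
    if r: "0 < r" "r < 1" for r
    using has_integral_Re[OF has_integral_Cauchy_coeff[OF f r, of 0]] by (simp add: c0_def)
  have mean2: "((\<lambda>t. Re (f (of_real r * cis t)) * cos (2 * t)) has_integral pi * r\<^sup>2 * c2) {0..2*pi}"
    if r: "0 < r" "r < 1" for r
  proof -
    \<comment> \<open>Adding the vanishing opposite coefficient turns the complex weight into the
      real weight \<open>cos (2 * t)\<close>, so that taking real parts involves only
      \<open>Re f\<close>.\<close>
    have "((\<lambda>t. (f (of_real r * cis t) * cis (- (real 2 * t)) + f (of_real r * cis t) * cis (real 2 * t)) / 2)
       has_integral (2 * pi * of_real r ^ 2 * (deriv ^^ 2) f 0 / fact 2 + 0) / 2) {0..2*pi}"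
      by (intro has_integral_divide has_integral_add has_integral_Cauchy_coeff[OF f r, of 2]
            has_integral_Cauchy_negative_coeff[OF f r]) simp
    from has_integral_Re[OF this] show ?thesis
      by (simp add: c2_def fact_numeral algebra_simps)
  qed
  define v where "v r t = Re (f (of_real r * cis t)) - q * ln r" for r t
  have v0: "0 \<le> v r t" and v1: "v r t \<le> M - q * ln r" if r: "0 < r" "r < 1" for r t
    using lower[of "of_real r * cis t"] upper[of "of_real r * cis t"] r
    by (auto simp: v_def norm_mult)
  have const: "((\<lambda>t. q * ln r) has_integral 2 * pi * (q * ln r)) {0..2*pi}" for r
    using has_integral_const_real[of "q * ln r" 0 "2 * pi"] by simp
  have const2: "((\<lambda>t. q * ln r * cos (2 * t)) has_integral 0) {0..2*pi}" for r
  proof -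
    have "((\<lambda>t. cos (2 * t)) has_integral sin (2 * (2 * pi)) / 2 - sin (2 * 0) / 2) {0..2*pi}"
      by (rule fundamental_theorem_of_calculus)
         (auto intro!: derivative_eq_intros simp flip: has_real_derivative_iff_has_vector_derivative)
    then have "((\<lambda>t. cos (2 * t)) has_integral 0) {0..2*pi}"
      using sin_npi2[of 4] by (simp add: mult_ac)
    from has_integral_mult_right[OF this, of "q * ln r"] show ?thesis by simp
  qed
  have Iv: "(v r has_integral 2 * pi * (c0 - q * ln r)) {0..2*pi}" if r: "0 < r" "r < 1" for r
    using has_integral_diff[OF mean[OF r] const[of r]] by (simp add: v_def[abs_def] algebra_simps)
  have Ivw: "((\<lambda>t. v r t * (1 + cos (2 * t))) has_integral pi * (2 * c0 + r\<^sup>2 * c2 - 2 * q * ln r)) {0..2*pi}"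
    if r: "0 < r" "r < 1" for r
    using has_integral_add[OF Iv[OF r] has_integral_diff[OF mean2[OF r] const2[of r]]]
    by (simp add: v_def[abs_def] algebra_simps)
  have ev: "eventually (\<lambda>r. 0 < r \<and> r < 1) (at_left (1::real))"
    using eventually_at_left_real[of 0 1] by (auto elim: eventually_mono)
  have lnlim: "((\<lambda>r. ln r) \<longlongrightarrow> 0) (at_left (1::real))"
    by (rule tendsto_eq_intros tendsto_ident_at | simp)+
  have sqlim: "((\<lambda>r. r\<^sup>2) \<longlongrightarrow> 1) (at_left (1::real))"
    by (rule tendsto_eq_intros tendsto_ident_at | simp)+
  show "0 \<le> c0"
  proof (rule tendsto_lowerbound)
    show "((\<lambda>r. c0 - q * ln r) \<longlongrightarrow> c0) (at_left (1::real))"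
      by (rule tendsto_eq_intros lnlim | simp)+
    show "eventually (\<lambda>r. 0 \<le> c0 - q * ln r) (at_left (1::real))"
      using ev
    proof eventually_elim
      case (elim r)
      then have "0 \<le> 2 * pi * (c0 - q * ln r)"
        using has_integral_nonneg[OF Iv] v0 by blast
      then show ?case using zero_le_mult_iff[of pi] pi_gt_zero by (smt (verit) zero_le_mult_iff)
    qed
  qed simp
  have w0: "0 \<le> 1 + cos (2 * t)" for t :: real
    using cos_ge_minus_one[of "2 * t"] by linarith
  show ge: "0 \<le> 2 * c0 + c2"
  proof (rule tendsto_lowerbound)
    show "((\<lambda>r. 2 * c0 + r\<^sup>2 * c2 - 2 * q * ln r) \<longlongrightarrow> 2 * c0 + c2) (at_left (1::real))"
      by (rule tendsto_eq_intros lnlim sqlim | simp)+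
    show "eventually (\<lambda>r. 0 \<le> 2 * c0 + r\<^sup>2 * c2 - 2 * q * ln r) (at_left (1::real))"
      using ev
    proof eventually_elim
      case (elim r)
      then have "0 \<le> pi * (2 * c0 + r\<^sup>2 * c2 - 2 * q * ln r)"
        using v0 w0 by (intro has_integral_nonneg[OF Ivw]) auto
      then show ?case using zero_le_mult_iff[of pi] pi_gt_zero by (smt (verit) zero_le_mult_iff)
    qed
  qed simp
  \<comment> \<open>With \<open>p = 1 + cos 2t\<close>, Bernoulli gives \<open>v (1 - n p / 2) \<le> v (1 - p / 2)^n \<le> (sup v) (sin t)^(2n)\<close>,
    whose mean tends to 0: the mass of \<open>v\<close> cannot concentrate on the zeros of \<open>p\<close>.\<close>
  define I where "I n = integral {0..2*pi} (\<lambda>t::real. (sin t ^ 2) ^ n)" for n :: nat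
  have fin: "2 * pi * c0 - real n / 2 * (pi * (2 * c0 + c2)) \<le> M * I n" for n
  proof (rule tendsto_le)
    show "((\<lambda>r. (M - q * ln r) * I n) \<longlongrightarrow> M * I n) (at_left (1::real))"
      by (rule tendsto_eq_intros lnlim sqlim | simp)+
    have "((\<lambda>r. 2 * pi * (c0 - q * ln r) - real n / 2 * (pi * (2 * c0 + r\<^sup>2 * c2 - 2 * q * ln r))) \<longlongrightarrow>
       2 * pi * (c0 - q * 0) - real n / 2 * (pi * (2 * c0 + 1 * c2 - 2 * q * 0))) (at_left (1::real))"
      by (intro tendsto_intros lnlim sqlim)
    then show "((\<lambda>r. 2 * pi * (c0 - q * ln r) - real n / 2 * (pi * (2 * c0 + r\<^sup>2 * c2 - 2 * q * ln r))) \<longlongrightarrow>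
       2 * pi * c0 - real n / 2 * (pi * (2 * c0 + c2))) (at_left (1::real))"
      by simp
    show "eventually (\<lambda>r. 2 * pi * (c0 - q * ln r) - real n / 2 * (pi * (2 * c0 + r\<^sup>2 * c2 - 2 * q * ln r))
       \<le> (M - q * ln r) * I n) (at_left (1::real))"
      using ev
    proof eventually_elim
      case (elim r)
      then have r: "0 < r" "r < 1" by auto
      have "((\<lambda>t. v r t - real n / 2 * (v r t * (1 + cos (2 * t)))) has_integral
         2 * pi * (c0 - q * ln r) - real n / 2 * (pi * (2 * c0 + r\<^sup>2 * c2 - 2 * q * ln r))) {0..2*pi}"
        by (intro has_integral_diff Iv[OF r] has_integral_mult_right Ivw[OF r])
      moreover have "((\<lambda>t. (M - q * ln r) * (sin t ^ 2) ^ n) has_integral (M - q * ln r) * I n) {0..2*pi}"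
        unfolding I_def
        by (intro has_integral_mult_right integrable_integral integrable_continuous_interval continuous_intros)
      moreover have "v r t - real n / 2 * (v r t * (1 + cos (2 * t))) \<le> (M - q * ln r) * (sin t ^ 2) ^ n" for t
      proof -
        have s: "sin t ^ 2 = 1 - (1 + cos (2 * t)) / 2"
          using cos_double_sin[of t] by (simp add: field_simps)
        have "v r t - real n / 2 * (v r t * (1 + cos (2 * t))) = v r t * (1 + real n * (- ((1 + cos (2 * t)) / 2)))"
          by (simp add: algebra_simps)
        also have "\<dots> \<le> v r t * (1 + - ((1 + cos (2 * t)) / 2)) ^ n"
          by (intro mult_left_mono Bernoulli_inequality v0[OF r]) simp
        also have "\<dots> = v r t * (sin t ^ 2) ^ n" by (simp add: s)
        also have "\<dots> \<le> (M - q * ln r) * (sin t ^ 2) ^ n"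
          by (intro mult_right_mono v1[OF r]) simp
        finally show ?thesis .
      qed
      ultimately show ?case by (rule has_integral_le)
    qed
  qed simp
  show "c0 = 0" if "2 * c0 + c2 = 0"
  proof -
    \<comment> \<open>When \<open>2 * c0 + c2 = 0\<close>, the term of \<open>fin\<close> that is
      linear in \<open>n\<close> is absent, and \<open>n\<close> may tend to infinity.\<close>
    have "(\<lambda>n. M * I n) \<longlonglongrightarrow> M * 0"
      unfolding I_def by (intro tendsto_mult_left sin_even_power_integral_tendsto_0)
    then have "2 * pi * c0 \<le> M * 0"
      by (rule tendsto_lowerbound) (use fin that in auto)
    with \<open>0 \<le> c0\<close> show ?thesis
      using mult_le_0_iff[of pi c0] pi_gt_zero by simp
  qed
qed

section \<open>The holomorphic logarithm of the outer root\<close>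

text \<open>\<open>P\<close> plays the part of \<open>z ^ q\<close> times the discriminant. By
  \<open>avoid\<close> the quantity under the square root in the quadratic formula stays off the
  branch cut, so the principal root gives a holomorphic zero-free \<open>u\<close> on the whole
  disc, and \<open>f\<close> is its logarithm.\<close>

lemma holomorphic_log_zero_free_poly:
  fixes P :: "complex poly"
  assumes q: "q \<ge> 2"
    and avoid: "\<And>z t. \<lbrakk>norm z < 1; z \<noteq> 0; \<bar>t\<bar> \<le> 2\<rbrakk> \<Longrightarrow> poly P z \<noteq> z ^ q * of_real t"
    and P0: "coeff P 0 \<noteq> 0"
  obtains f M where "f holomorphic_on ball 0 1"
    and "\<And>z. \<lbrakk>norm z < 1; z \<noteq> 0\<rbrakk> \<Longrightarrow> real q * ln (norm z) \<le> Re (f z)"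
    and "\<And>z. norm z < 1 \<Longrightarrow> Re (f z) \<le> M"
    and "Re (f 0) = ln (norm (coeff P 0))"
    and "(deriv ^^ 2) f 0 / 2 = coeff P 2 / coeff P 0 - (coeff P 1 / coeff P 0)\<^sup>2 / 2"
proof -
  have nz: "poly P z \<noteq> 0" if "norm z < 1" for z
    using avoid[of z 0] that P0 by (cases "z = 0") (auto simp: poly_0_coeff_0)
  \<comment> \<open>\<open>u\<close> and \<open>u'\<close> are the roots of \<open>X\<^sup>2 - P X + z^(2q)\<close>; \<open>u = P - z^(2q) / u\<close> shows that \<open>u\<close> and \<open>P\<close>
    have the same Taylor coefficients below order \<open>2q\<close>.\<close>
  define D where "D z = 1 - 4 * z ^ (2 * q) / (poly P z)\<^sup>2" for z
  define s where "s z = csqrt (D z)" for z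
  define u where "u z = poly P z * (1 + s z) / 2" for z
  define u' where "u' z = poly P z * (1 - s z) / 2" for z
  \<comment> \<open>If \<open>D z \<le> 0\<close>, then \<open>w = 2 * z ^ q / P\<close> is real
    with modulus at least 1, so \<open>P / z ^ q = 2 / w\<close> lies in [-2, 2], against
    \<open>avoid\<close>.\<close>
  have D: "D z \<notin> \<real>\<^sub>\<le>\<^sub>0" if z: "norm z < 1" for z
  proof
    assume "D z \<in> \<real>\<^sub>\<le>\<^sub>0"
    then obtain x where x: "x \<le> 0" "D z = of_real x"
      by (auto elim!: nonpos_Reals_cases)
    define w where "w = 2 * z ^ q / poly P z"
    define y where "y = sqrt (1 - x)"
    have y: "y \<ge> 1" using x by (simp add: y_def)
    have "w\<^sup>2 = 1 - D z"
      by (simp add: w_def D_def power_divide power_mult_distrib mult.commute flip: power_mult)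
    also have "\<dots> = (of_real y)\<^sup>2"
      using x by (simp add: y_def flip: of_real_power)
    finally have "w = of_real y \<or> w = of_real (- y)"
      by (auto simp: power2_eq_iff)
    then obtain y' where y': "w = of_real y'" "\<bar>y'\<bar> \<ge> 1"
      using y by force
    have "z \<noteq> 0"
      using y' q by (auto simp: w_def power_0_left)
    moreover have "poly P z = z ^ q * of_real (2 / y')"
      using y'(1)[symmetric] y'(2) nz[OF z] by (auto simp: w_def field_simps)
    moreover have "\<bar>2 / y'\<bar> \<le> 2"
      using y' by (simp add: field_simps)
    ultimately show False
      using avoid[OF z] by blast
  qed
  have s2: "(s z)\<^sup>2 = D z" for z
    by (simp add: s_def)
  have Re_s: "Re (s z) \<ge> 0" for z
    using csqrt_principal[of "D z"] by (auto simp: s_def)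
  have uu': "u z * u' z = z ^ (2 * q)" if "norm z < 1" for z
  proof -
    have "u z * u' z = (poly P z)\<^sup>2 * (1 - (s z)\<^sup>2) / 4"
      by (simp add: u_def u'_def power2_eq_square algebra_simps)
    also have "\<dots> = z ^ (2 * q)"
      using nz[OF that] by (simp add: s2 D_def)
    finally show ?thesis .
  qed
  have unz: "u z \<noteq> 0" if "norm z < 1" for z
  proof -
    have "1 + s z \<noteq> 0"
      using Re_s[of z] by (auto simp: complex_eq_iff)
    then show ?thesis using nz[OF that] by (simp add: u_def)
  qed
  have hol_D: "D holomorphic_on ball 0 1"
    unfolding D_def using nz by (intro holomorphic_intros) auto
  have hol_u: "u holomorphic_on ball 0 1"
    unfolding u_def s_def using D by (intro holomorphic_intros hol_D) auto
  obtain f where f: "f holomorphic_on ball 0 1" "\<And>z. z \<in> ball 0 1 \<Longrightarrow> exp (f z) = u z"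
    using holomorphic_logarithm_exists[OF convex_ball open_ball hol_u, of 0] unz
    by (metis centre_in_ball mem_ball_0 zero_less_one)
  have Re_f: "Re (f z) = ln (norm (u z))" if "norm z < 1" for z
    using f(2)[of z] that norm_exp_eq_Re[of "f z"] by (metis ln_exp mem_ball_0)
  have "compact (poly P ` cball 0 1)"
    by (intro compact_continuous_image continuous_intros compact_cball)
  then obtain B where B: "B > 0" "\<And>z. norm z < 1 \<Longrightarrow> norm (poly P z) \<le> B"
    unfolding bounded_pos by (force dest!: compact_imp_bounded simp: bounded_pos)
  show thesis
  proof (rule that[OF f(1)])
    fix z :: complex
    assume z: "norm z < 1" "z \<noteq> 0"
    \<comment> \<open>The principal root has nonnegative real part, so \<open>u\<close> is the
      larger of the two roots; hence its squared modulus is at least that of the product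
      \<open>u * u' = z ^ (2 * q)\<close>.\<close>
    have "norm (1 - s z) \<le> norm (1 + s z)"
      unfolding norm_complex_def using Re_s[of z] by (auto simp: power2_eq_square algebra_simps)
    then have "norm (u' z) \<le> norm (u z)"
      by (simp add: u_def u'_def norm_mult norm_divide mult_left_mono)
    then have "norm (u z) * norm (u' z) \<le> norm (u z) * norm (u z)"
      by (intro mult_left_mono) auto
    then have "(norm z ^ q)\<^sup>2 \<le> (norm (u z))\<^sup>2"
      using uu'[OF z(1)] by (simp add: power2_eq_square norm_power mult.commute flip: norm_mult power_mult power_add mult_2)
    then have "norm z ^ q \<le> norm (u z)"
      by (rule power2_le_imp_le) simp
    then have "ln (norm z ^ q) \<le> ln (norm (u z))"
      using z by (simp add: unz)
    then show "real q * ln (norm z) \<le> Re (f z)"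
      using z by (simp add: Re_f ln_realpow)
  next
    fix z :: complex
    assume z: "norm z < 1"
    \<comment> \<open>The estimate is made for \<open>P * s\<close>, whose square is a polynomial; a
      bound on \<open>s\<close> alone would need a lower bound on \<open>P\<close>.\<close>
    have "norm (poly P z * s z) ^ 2 = norm ((poly P z)\<^sup>2 - 4 * z ^ (2 * q))"
      using nz[OF z] by (simp add: s2 D_def power_mult_distrib algebra_simps flip: norm_power)
    also have "\<dots> \<le> norm (poly P z) ^ 2 + 4 * norm z ^ (2 * q)"
      by (rule order_trans[OF norm_triangle_ineq4]) (simp add: norm_mult norm_power)
    also have "\<dots> \<le> B ^ 2 + 4 * 1"
      using z B by (intro add_mono mult_left_mono power_mono power_le_one) auto
    also have "\<dots> \<le> (B + 2) ^ 2"
      using B(1) by (simp add: power2_eq_square algebra_simps)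
    finally have "norm (poly P z * s z) \<le> B + 2"
      by (rule power2_le_imp_le) (use B in simp)
    then have "norm (poly P z + poly P z * s z) \<le> B + (B + 2)"
      by (intro order_trans[OF norm_triangle_ineq] add_mono B z)
    then have "norm (u z) \<le> B + 1"
      by (simp add: u_def algebra_simps norm_divide)
    then show "Re (f z) \<le> ln (B + 1)"
      using z B by (simp add: Re_f unz)
  next
    have "s 0 = 1" using q by (simp add: s_def D_def power_0_left)
    then show "Re (f 0) = ln (norm (coeff P 0))"
      by (simp add: Re_f u_def poly_0_coeff_0)
  next
    let ?F = "fps_expansion f 0" and ?U = "fps_expansion u 0"
    have F: "f has_fps_expansion ?F" and U: "u has_fps_expansion ?U"
      using f(1) hol_u by (auto intro!: has_fps_expansion_fps_expansion[of "ball 0 1"])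
    have U0: "u 0 \<noteq> 0" by (rule unz) simp
    have coeff_u: "fps_nth ?U k = coeff P k" if "k < 3" for k
    proof -
      have ev: "eventually (\<lambda>z. norm z < 1) (nhds (0::complex))"
        using eventually_nhds_in_open[of "ball 0 1" "0::complex"] by (simp add: eventually_mono)
      have "eventually (\<lambda>z. u z = poly P z - z ^ (2 * q) * inverse (u z)) (nhds 0)"
        using ev
      proof eventually_elim
        case (elim z)
        have "u z + u' z = poly P z"
          by (simp add: u_def u'_def field_simps)
        moreover have "u' z = z ^ (2 * q) * inverse (u z)"
          using uu'[OF elim] unz[OF elim] by (simp add: field_simps)
        ultimately show ?case by (simp add: algebra_simps)
      qed
      note ueq = this
      have "(\<lambda>z. poly P z - z ^ (2 * q) * inverse (u z)) has_fps_expansion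
          fps_of_poly P - fps_X ^ (2 * q) * inverse ?U"
        using U0 has_fps_expansion_imp_0_eq_fps_nth_0[OF U]
        by (intro has_fps_expansion_diff has_fps_expansion_mult has_fps_expansion_fps_X_power
              has_fps_expansion_inverse U) (simp_all add: has_fps_expansion_def)
      then have "u has_fps_expansion fps_of_poly P - fps_X ^ (2 * q) * inverse ?U"
        by (subst has_fps_expansion_cong[OF ueq refl])
      then have "?U = fps_of_poly P - fps_X ^ (2 * q) * inverse ?U"
        using U fps_expansion_unique_complex by blast
      then have "fps_nth ?U k = fps_nth (fps_of_poly P - fps_X ^ (2 * q) * inverse ?U) k"
        by simp
      then show ?thesis
        using that q by (simp add: fps_X_power_mult_nth)
    qed
    \<comment> \<open>Comparing coefficients in \<open>u' = f' * u\<close> (here with derivatives)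
      yields the coefficients of the logarithm from those of \<open>u\<close>.\<close>
    have "eventually (\<lambda>z. deriv u z = deriv f z * u z) (nhds 0)"
    proof -
      have "deriv u z = deriv f z * u z" if "z \<in> ball 0 1" for z
      proof -
        have "(f has_field_derivative deriv f z) (at z)"
          by (rule holomorphic_derivI[OF f(1) open_ball that])
        then have "((\<lambda>z. exp (f z)) has_field_derivative exp (f z) * deriv f z) (at z)"
          by (rule DERIV_fun_exp)
        then have "(u has_field_derivative exp (f z) * deriv f z) (at z)"
          by (rule has_field_derivative_transform_within_open[OF _ open_ball that]) (simp add: f)
        then show ?thesis
          using that f(2) by (simp add: DERIV_imp_deriv)
      qed
      then show ?thesis
        using eventually_nhds_in_open[of "ball 0 1" "0::complex"] by (auto elim!: eventually_mono)
    qed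
    note deq = this
    have "(\<lambda>z. deriv f z * u z) has_fps_expansion fps_deriv ?F * ?U"
      by (intro fps_expansion_intros F U)
    then have "deriv u has_fps_expansion fps_deriv ?F * ?U"
      by (subst has_fps_expansion_cong[OF deq refl])
    then have eq: "fps_deriv ?U = fps_deriv ?F * ?U"
      using has_fps_expansion_deriv[OF U] fps_expansion_unique_complex by blast
    have "fps_nth (fps_deriv ?U) 0 = fps_nth (fps_deriv ?F * ?U) 0"
         "fps_nth (fps_deriv ?U) 1 = fps_nth (fps_deriv ?F * ?U) 1"
      by (simp_all only: eq)
    then have e1: "coeff P 1 = fps_nth ?F 1 * coeff P 0"
      and e2: "2 * coeff P 2 = fps_nth ?F 1 * coeff P 1 + 2 * fps_nth ?F 2 * coeff P 0"
      by (simp_all add: fps_mult_nth coeff_u numeral_2_eq_2)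
    have "fps_nth ?F 2 = coeff P 2 / coeff P 0 - (coeff P 1 / coeff P 0)\<^sup>2 / 2"
      using e2 P0 unfolding e1 by (simp add: power2_eq_square field_simps)
    moreover have "fps_nth ?F 2 = (deriv ^^ 2) f 0 / 2"
      using fps_nth_fps_expansion[OF F, of 2] by (simp add: fact_numeral)
    ultimately show "(deriv ^^ 2) f 0 / 2 = coeff P 2 / coeff P 0 - (coeff P 1 / coeff P 0)\<^sup>2 / 2"
      by simp
  qed
qed

section \<open>The discriminant as a polynomial\<close>

text \<open>The solutions of \<open>jsol\<close> as polynomials in the spectral parameter. The
  general field permits complex values of that parameter.\<close>

fun jpoly :: "(int \<Rightarrow> 'a::field) \<Rightarrow> (int \<Rightarrow> 'a) \<Rightarrow> 'a \<Rightarrow> 'a \<Rightarrow> nat \<Rightarrow> 'a poly" where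
  "jpoly a b x0 x1 0 = [:x0:]"
| "jpoly a b x0 x1 (Suc 0) = [:x1:]"
| "jpoly a b x0 x1 (Suc (Suc n)) = smult (1 / a (int n + 1))
     ([:- b (int n + 1), 1:] * jpoly a b x0 x1 (Suc n) - smult (a (int n)) (jpoly a b x0 x1 n))"

lemma poly_jpoly_of_real:
  fixes a b :: "int \<Rightarrow> real"
  shows "poly (jpoly (\<lambda>n. of_real (a n)) (\<lambda>n. of_real (b n)) (of_real x0) (of_real x1) n) (of_real l :: complex)
       = of_real (jsol a b l x0 x1 n)"
  by (induction a b l x0 x1 n rule: jsol.induct) (simp_all add: diff_divide_distrib add_divide_distrib algebra_simps)

lemma jpoly_smult: "jpoly a b (c * x0) (c * x1) n = smult c (jpoly a b x0 x1 n)"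
  by (induction a b x0 x1 n rule: jpoly.induct)
     (simp_all add: smult_diff_right mult_ac smult_add_right)

lemma degree_jpoly: "degree (jpoly a b x0 x1 n) \<le> n - 1"
proof (induction a b x0 x1 n rule: jpoly.induct)
  case (3 a b x0 x1 n)
  have "degree ([:- b (int n + 1), 1:] * jpoly a b x0 x1 (Suc n)) \<le> 1 + n"
    using 3(1) by (intro order_trans[OF degree_mult_le] add_mono) auto
  then have "degree ([:- b (int n + 1), 1:] * jpoly a b x0 x1 (Suc n) - smult (a (int n)) (jpoly a b x0 x1 n)) \<le> 1 + n"
    using 3(2) by (intro degree_diff_le) (auto intro: order_trans[OF degree_smult_le])
  then show ?case
    by (simp add: order_trans[OF degree_smult_le])
qed auto

lemma coeff_jpoly_top:
  "coeff (jpoly a b x0 x1 (Suc n)) n = x1 / (\<Prod>j=1..n. a (int j))"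
proof (induction n)
  case (Suc n)
  have "coeff (jpoly a b x0 x1 (Suc n)) (Suc n) = 0" "coeff (jpoly a b x0 x1 n) (Suc n) = 0"
    using degree_jpoly[of a b x0 x1 "Suc n"] degree_jpoly[of a b x0 x1 n]
    by (auto intro!: coeff_eq_0)
  then show ?case
    using Suc by (simp add: field_simps add.commute)
qed simp

definition discr_poly :: "(int \<Rightarrow> 'a::field) \<Rightarrow> (int \<Rightarrow> 'a) \<Rightarrow> nat \<Rightarrow> 'a poly" where
  "discr_poly a b q = jpoly a b 0 1 (q + 1) + jpoly a b 1 0 q"

lemma poly_discr_poly_of_real:
  fixes a b :: "int \<Rightarrow> real"
  shows "poly (discr_poly (\<lambda>n. of_real (a n)) (\<lambda>n. of_real (b n)) q) (of_real l :: complex)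
       = of_real (discr a b q l)"
  using poly_jpoly_of_real[of a b 0 1 "q + 1" l] poly_jpoly_of_real[of a b 1 0 q l]
  by (simp add: discr_poly_def discr_def phi_def theta_def)

text \<open>The \<open>theta\<close> part has degree below \<open>q\<close>, so the leading
  coefficient is that of the \<open>phi\<close> part, the inverse of
  \<open>a 1 * ... * a q\<close>.\<close>

lemma degree_discr_poly:
  assumes "q \<ge> 1" "\<forall>n. a n \<noteq> 0"
  shows "degree (discr_poly a b q) = q"
proof (rule antisym)
  show "degree (discr_poly a b q) \<le> q"
    unfolding discr_poly_def using degree_jpoly[of a b 0 1 "q + 1"] degree_jpoly[of a b 1 0 q]
    by (intro degree_add_le) auto
  have "coeff (jpoly a b 1 0 q) q = 0"
    using degree_jpoly[of a b 1 0 q] assms by (intro coeff_eq_0) auto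
  then have "coeff (discr_poly a b q) q \<noteq> 0"
    using coeff_jpoly_top[of a b 0 1 q] assms by (simp add: discr_poly_def)
  then show "q \<le> degree (discr_poly a b q)"
    by (rule le_degree)
qed

section \<open>Floquet solutions and the location of the spectrum\<close>

lemma poly_jpoly_rec:
  assumes "a (int n + 1) \<noteq> 0"
  shows "a (int n + 1) * poly (jpoly a b x0 x1 (Suc (Suc n))) l =
     (l - b (int n + 1)) * poly (jpoly a b x0 x1 (Suc n)) l - a (int n) * poly (jpoly a b x0 x1 n) l"
  using assms by (simp add: algebra_simps)

text \<open>The Wronskian is constant. After one period, where \<open>a (int q) = a 0\<close>, this
  says that the monodromy matrix has determinant 1.\<close>

lemma jpoly_wronskian:
  assumes "\<forall>n. a n \<noteq> 0"
  shows "a (int n) * (poly (jpoly a b 1 0 n) l * poly (jpoly a b 0 1 (Suc n)) l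
           - poly (jpoly a b 1 0 (Suc n)) l * poly (jpoly a b 0 1 n) l) = a 0"
proof (induction n)
  case (Suc n)
  let ?t = "\<lambda>n. poly (jpoly a b 1 0 n) l" and ?p = "\<lambda>n. poly (jpoly a b 0 1 n) l"
  have rec: "a (int n + 1) * poly (jpoly a b x0 x1 (Suc (Suc n))) l =
     (l - b (int n + 1)) * poly (jpoly a b x0 x1 (Suc n)) l - a (int n) * poly (jpoly a b x0 x1 n) l" for x0 x1
    using assms by (intro poly_jpoly_rec) simp
  have "a (int (Suc n)) * (?t (Suc n) * ?p (Suc (Suc n)) - ?t (Suc (Suc n)) * ?p (Suc n))
     = ?t (Suc n) * (a (int n + 1) * ?p (Suc (Suc n))) - (a (int n + 1) * ?t (Suc (Suc n))) * ?p (Suc n)"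
    by (simp only: of_nat_Suc add.commute[of 1] right_diff_distrib mult_ac)
  also have "\<dots> = a (int n) * (?t n * ?p (Suc n) - ?t (Suc n) * ?p n)"
    by (simp only: rec) (simp only: algebra_simps)
  finally show ?case using Suc by simp
qed simp

lemma jpoly_combine:
  "poly (jpoly a b x0 x1 n) l = x0 * poly (jpoly a b 1 0 n) l + x1 * poly (jpoly a b 0 1 n) l"
  by (induction n rule: induct_nat_012)
     (simp_all add: diff_divide_distrib algebra_simps)

text \<open>A nonzero row of the matrix minus \<mu> determines the eigenvector up to scaling; if
  both rows vanish, any vector will do.\<close>

lemma matrix2_eigenvector:
  fixes m11 m12 m21 m22 \<mu> :: "'a::field"
  assumes "(m11 - \<mu>) * (m22 - \<mu>) = m12 * m21"
  obtains x0 x1 where "x0 \<noteq> 0 \<or> x1 \<noteq> 0"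
    "m11 * x0 + m12 * x1 = \<mu> * x0" "m21 * x0 + m22 * x1 = \<mu> * x1"
proof (cases "m12 = 0 \<and> m11 = \<mu>")
  case False
  then show thesis
    using that[of m12 "\<mu> - m11"] assms by (auto simp: algebra_simps)
next
  case True
  show thesis
  proof (cases "m21 = 0 \<and> m22 = \<mu>")
    case False
    then show thesis
      using that[of "m22 - \<mu>" "- m21"] True by (auto simp: algebra_simps)
  next
    case True': True
    show thesis using that[of 1 0] True True' by simp
  qed
qed

text \<open>
  A value in \<open>[-2, 2]\<close> yields a Floquet solution with multiplier of modulus 1, and then the
  self-adjointness of the recursion (the current \<open>J\<close> is the same after one period) makes \<open>l\<close> real.
\<close>

lemma discr_poly_real_value_imp_real:
  fixes a b :: "int \<Rightarrow> real" and l :: complex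
  assumes apos: "\<forall>n. a n > 0" and per: "a (int q) = a 0" and q: "q \<ge> 2"
    and val: "poly (discr_poly (\<lambda>n. of_real (a n)) (\<lambda>n. of_real (b n)) q) l = of_real t" and t: "\<bar>t\<bar> \<le> 2"
  shows "Im l = 0"
proof -
  define a' b' where "a' = (\<lambda>n. complex_of_real (a n))" and "b' = (\<lambda>n. complex_of_real (b n))"
  have a'nz: "\<forall>n. a' n \<noteq> 0"
    using apos by (auto simp: a'_def less_imp_neq[symmetric])
  define \<theta> \<phi> where "\<theta> n = poly (jpoly a' b' 1 0 n) l" and "\<phi> n = poly (jpoly a' b' 0 1 n) l" for n
  have trace: "\<theta> q + \<phi> (Suc q) = of_real t"
    using val by (simp add: discr_poly_def \<theta>_def \<phi>_def a'_def b'_def add.commute)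
  have "a' (int q) = a' 0" by (simp add: a'_def per)
  then have det: "\<theta> q * \<phi> (Suc q) - \<theta> (Suc q) * \<phi> q = 1"
    using jpoly_wronskian[OF a'nz, of q b' l] a'nz by (simp add: \<theta>_def \<phi>_def)
  \<comment> \<open>A root of \<open>X ^ 2 - t * X + 1\<close>, the characteristic polynomial of the
    monodromy matrix; it lies on the unit circle because
    \<open>\<bar>t\<bar> \<le> 2\<close>.\<close>
  define \<mu> where "\<mu> = Complex (t / 2) (sqrt (1 - (t / 2)\<^sup>2))"
  have t2: "(t / 2)\<^sup>2 \<le> 1"
    using t by (simp add: abs_square_le_1)
  then have norm_\<mu>: "norm \<mu> = 1"
    by (simp add: \<mu>_def norm_complex_def)
  have "\<mu>\<^sup>2 - of_real t * \<mu> + 1 = 0"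
    using t2 by (simp add: \<mu>_def complex_eq_iff power2_eq_square)
  then have "(\<theta> q - \<mu>) * (\<phi> (Suc q) - \<mu>) = \<phi> q * \<theta> (Suc q)"
    using det unfolding trace[symmetric] by (simp add: algebra_simps power2_eq_square)
  then obtain x0 x1 where x: "x0 \<noteq> 0 \<or> x1 \<noteq> 0"
    "\<theta> q * x0 + \<phi> q * x1 = \<mu> * x0" "\<theta> (Suc q) * x0 + \<phi> (Suc q) * x1 = \<mu> * x1"
    by (rule matrix2_eigenvector)
  define \<psi> where "\<psi> n = poly (jpoly a' b' x0 x1 n) l" for n
  have comb: "\<psi> n = \<theta> n * x0 + \<phi> n * x1" for n
    by (simp only: \<psi>_def \<theta>_def \<phi>_def jpoly_combine[of a' b' x0 x1] mult.commute)
  have \<psi>q: "\<psi> q = \<mu> * \<psi> 0" "\<psi> (Suc q) = \<mu> * \<psi> (Suc 0)"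
    using x by (simp_all add: comb) (simp_all add: \<theta>_def \<phi>_def)
  have rec: "a' (int n + 1) * \<psi> (Suc (Suc n)) = (l - b' (int n + 1)) * \<psi> (Suc n) - a' (int n) * \<psi> n" for n
    unfolding \<psi>_def using a'nz by (intro poly_jpoly_rec) simp
  define J where "J n = a (int n) * Im (cnj (\<psi> n) * \<psi> (Suc n))" for n
  have step: "J (Suc n) - J n = Im l * (norm (\<psi> (Suc n)))\<^sup>2" for n
  proof -
    have "J (Suc n) = Im (cnj (\<psi> (Suc n)) * (a' (int n + 1) * \<psi> (Suc (Suc n))))"
      by (simp add: J_def a'_def algebra_simps)
    also have "\<dots> = Im (cnj (\<psi> (Suc n)) * ((l - b' (int n + 1)) * \<psi> (Suc n) - a' (int n) * \<psi> n))"
      by (simp only: rec)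
    also have "\<dots> = Im l * (norm (\<psi> (Suc n)))\<^sup>2 + J n"
      by (simp only: cmod_power2) (simp add: J_def a'_def b'_def algebra_simps power2_eq_square)
    finally show ?thesis by simp
  qed
  have "(\<Sum>n<q. Im l * (norm (\<psi> (Suc n)))\<^sup>2) = J q - J 0"
    by (simp only: step[symmetric] sum_lessThan_telescope)
  also have "\<dots> = 0"
  proof -
    have "cnj (\<psi> q) * \<psi> (Suc q) = (cnj \<mu> * \<mu>) * (cnj (\<psi> 0) * \<psi> (Suc 0))"
      by (simp add: \<psi>q)
    also have "cnj \<mu> * \<mu> = 1"
      using complex_norm_square[of \<mu>] norm_\<mu> by (simp add: mult.commute)
    finally show ?thesis by (simp add: J_def per)
  qed
  finally have "Im l * (\<Sum>n<q. (norm (\<psi> (Suc n)))\<^sup>2) = 0"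
    by (simp add: sum_distrib_left)
  \<comment> \<open>Since \<open>q \<ge> 2\<close>, a vanishing sum kills \<psi> at 1 and 2; the
    recursion run backwards kills it at 0 too, so both initial values would be 0.\<close>
  moreover have "(\<Sum>n<q. (norm (\<psi> (Suc n)))\<^sup>2) \<noteq> 0"
  proof
    assume "(\<Sum>n<q. (norm (\<psi> (Suc n)))\<^sup>2) = 0"
    then have z: "\<psi> (Suc n) = 0" if "n < q" for n
      using that by (subst (asm) sum_nonneg_eq_0_iff) auto
    then have "\<psi> (Suc 0) = 0" "\<psi> (Suc (Suc 0)) = 0"
      using q by auto
    then have "x1 = 0" "\<psi> 0 = 0"
      using rec[of 0] a'nz by (simp_all add: \<psi>_def)
    then show False using x(1) by (simp add: \<psi>_def)
  qed
  ultimately show ?thesis by simp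
qed

text \<open>A nonconstant polynomial is large far from 0, so the spectrum is bounded and
  \<open>Inf\<close> and \<open>Sup\<close> do bound it. The width is positive because the
  discriminant takes the values 0 and 1 at two distinct real points.\<close>

lemma jspec_bounds:
  fixes a b :: "int \<Rightarrow> real"
  assumes apos: "\<forall>n. a n > 0" and per: "a (int q) = a 0" and q: "q \<ge> 2"
    and norm: "normalised a b q"
  shows "half_width a b q > 0" and "\<And>l. l \<in> jspec a b q \<Longrightarrow> \<bar>l\<bar> \<le> half_width a b q"
proof -
  let ?D = "discr_poly (\<lambda>n. complex_of_real (a n)) (\<lambda>n. of_real (b n)) q"
  have deg: "degree ?D = q"
    using q apos by (intro degree_discr_poly) (auto simp: less_imp_neq[symmetric])
  \<comment> \<open>The fundamental theorem of algebra supplies a complex solution, and the Floquet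
    argument makes it real.\<close>
  have attained: "\<exists>l. discr a b q l = t" if "\<bar>t\<bar> \<le> 2" for t
  proof -
    have deg': "degree (?D + [:- of_real t:]) = q"
      using deg q by (subst degree_add_eq_left) auto
    have "\<not> (\<exists>c p. c \<noteq> 0 \<and> p = 0 \<and> ?D + [:- of_real t:] = pCons c p)"
      using deg' q by (metis degree_pCons_0 not_numeral_le_zero)
    then obtain z where z: "poly (?D + [:- of_real t:]) z = 0"
      using fundamental_theorem_of_algebra_alt by blast
    then have z': "poly ?D z = of_real t" by simp
    then have "Im z = 0"
      using discr_poly_real_value_imp_real[OF apos per q _ that] by blast
    then have "z = of_real (Re z)" by (simp add: complex_eq_iff)
    then have "complex_of_real (discr a b q (Re z)) = of_real t"
      using z' poly_discr_poly_of_real[of a b q "Re z"] by simp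
    then show ?thesis by auto
  qed
  obtain c p where cp: "?D = pCons c p" by (cases ?D)
  then have "p \<noteq> 0" using deg q by auto
  \<comment> \<open>Any constant above 2 would do in place of 3.\<close>
  then obtain r where r: "\<And>z. r \<le> norm z \<Longrightarrow> 3 \<le> norm (poly ?D z)"
    using poly_infinity[of p 3 c] cp by auto
  have bdd: "\<bar>l\<bar> \<le> r" if "l \<in> jspec a b q" for l
    using that r[of "of_real l"] by (force simp: jspec_def poly_discr_poly_of_real)
  have bdd_above: "bdd_above (jspec a b q)"
    using bdd by (intro bdd_aboveI[of _ r]) (auto simp: abs_le_iff)
  have bdd_below: "bdd_below (jspec a b q)"
    using bdd by (intro bdd_belowI[of _ "- r"]) (force simp: abs_le_iff)
  have hw: "half_width a b q = spec_top a b q" "spec_bot a b q = - spec_top a b q"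
    using norm by (auto simp: half_width_def normalised_def)
  show le: "\<bar>l\<bar> \<le> half_width a b q" if "l \<in> jspec a b q" for l
    using cSup_upper[OF that bdd_above] cInf_lower[OF that bdd_below] hw
    by (simp add: spec_top_def spec_bot_def abs_le_iff)
  obtain l0 l1 where l: "discr a b q l0 = 0" "discr a b q l1 = 1"
    using attained[of 0] attained[of 1] by auto
  then have "l0 \<noteq> l1" by auto
  moreover have "\<bar>l0\<bar> \<le> half_width a b q" "\<bar>l1\<bar> \<le> half_width a b q"
    using l by (auto intro!: le simp: jspec_def)
  ultimately show "half_width a b q > 0" by linarith
qed

section \<open>The discriminant in the Joukowski coordinate\<close>

text \<open>
  The recursion of \<open>jpoly\<close> at \<open>l = h (z + 1 / z)\<close>, with the \<open>n\<close>-th term multiplied by \<open>z^n\<close>; this turns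
  the leading coefficients in \<open>l\<close> into the lowest coefficients in \<open>z\<close>.
\<close>

fun rpoly :: "(int \<Rightarrow> 'a::field) \<Rightarrow> (int \<Rightarrow> 'a) \<Rightarrow> 'a \<Rightarrow> 'a \<Rightarrow> 'a \<Rightarrow> nat \<Rightarrow> 'a poly" where
  "rpoly a b h x0 x1 0 = [:x0:]"
| "rpoly a b h x0 x1 (Suc 0) = [:x1:]"
| "rpoly a b h x0 x1 (Suc (Suc n)) = smult (1 / a (int n + 1))
     ([:h, - b (int n + 1), h:] * rpoly a b h x0 x1 (Suc n) - smult (a (int n)) (pCons 0 (pCons 0 (rpoly a b h x0 x1 n))))"

text \<open>The value at index 1 carries one factor \<open>z\<close>, hence the initial value
  \<open>z * x1\<close>.\<close>

lemma poly_rpoly: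
  assumes "z \<noteq> 0"
  shows "poly (rpoly a b h x0 (z * x1) n) z = z ^ n * poly (jpoly a b x0 x1 n) (h * (z + 1 / z))"
proof (induction n rule: induct_nat_012)
  case (ge2 n)
  define l where "l = h * (z + 1 / z)"
  have l: "h + z * (- b (int n + 1) + z * h) = z * (l - b (int n + 1))"
    using assms by (simp add: l_def field_simps)
  have "poly (rpoly a b h x0 (z * x1) (Suc (Suc n))) z = ((h + z * (- b (int n + 1) + z * h)) *
      poly (rpoly a b h x0 (z * x1) (Suc n)) z - a (int n) * (z * (z * poly (rpoly a b h x0 (z * x1) n) z))) / a (int n + 1)"
    by (simp add: diff_divide_distrib add_divide_distrib algebra_simps)
  also have "\<dots> = z ^ Suc (Suc n) * poly (jpoly a b x0 x1 (Suc (Suc n))) l"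
    unfolding l ge2 l_def[symmetric] by (simp add: algebra_simps diff_divide_distrib add_divide_distrib)
  finally show ?case by (simp only: l_def)
qed (use assms in auto)

text \<open>Starting the first summand with 1 instead of \<open>z\<close> saves one factor
  \<open>z\<close>, so both summands carry exactly \<open>z ^ q\<close>.\<close>

definition rdiscr_poly :: "(int \<Rightarrow> 'a::field) \<Rightarrow> (int \<Rightarrow> 'a) \<Rightarrow> 'a \<Rightarrow> nat \<Rightarrow> 'a poly" where
  "rdiscr_poly a b h q = rpoly a b h 0 1 (q + 1) + rpoly a b h 1 0 q"

lemma poly_rdiscr_poly:
  assumes "z \<noteq> 0"
  shows "poly (rdiscr_poly a b h q) z = z ^ q * poly (discr_poly a b q) (h * (z + 1 / z))"
proof -
  have "poly (rpoly a b h 0 1 (Suc q)) z = z ^ Suc q * poly (jpoly a b 0 (1 / z) (Suc q)) (h * (z + 1 / z))"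
    using poly_rpoly[OF assms, of a b h 0 "1 / z" "Suc q"] assms by simp
  also have "\<dots> = z ^ q * poly (jpoly a b 0 1 (Suc q)) (h * (z + 1 / z))"
    using jpoly_smult[of a b "1 / z" 0 1 "Suc q"] assms by simp
  finally have "poly (rpoly a b h 0 1 (Suc q)) z = \<dots>" .
  moreover have "poly (rpoly a b h 1 0 q) z = z ^ q * poly (jpoly a b 1 0 q) (h * (z + 1 / z))"
    using poly_rpoly[OF assms, of a b h 1 0 q] by simp
  ultimately show ?thesis
    by (simp add: rdiscr_poly_def discr_poly_def algebra_simps del: rpoly.simps jpoly.simps)
qed

context
  fixes a b :: "int \<Rightarrow> 'a::field_char_0" and h :: 'a
  assumes nz: "\<forall>n. a n \<noteq> 0" "h \<noteq> 0"
begin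

lemma coeff_0_rpoly_0_1: "coeff (rpoly a b h 0 1 (Suc n)) 0 = h ^ n / (\<Prod>j=1..n. a (int j))"
  by (induction n) (simp_all add: coeff_mult add.commute)

lemma coeff_1_rpoly_0_1:
  "coeff (rpoly a b h 0 1 (Suc n)) 1 = - (h ^ n / (\<Prod>j=1..n. a (int j))) * ((\<Sum>j=1..n. b (int j)) / h)"
proof (induction n)
  case (Suc n)
  have "coeff (rpoly a b h 0 1 (Suc (Suc n))) 1 = 
    (h * coeff (rpoly a b h 0 1 (Suc n)) 1 - b (int n + 1) * coeff (rpoly a b h 0 1 (Suc n)) 0) / a (int n + 1)"
    by (simp add: coeff_pCons)
  also have "\<dots> = - (h ^ Suc n / (\<Prod>j=1..Suc n. a (int j))) * ((\<Sum>j=1..Suc n. b (int j)) / h)"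
    unfolding Suc coeff_0_rpoly_0_1 using nz by (simp add: field_simps)
  finally show ?case .
qed simp

text \<open>Without the \<open>a\<close> terms the recursion is a product of \<open>n\<close>
  factors \<open>h - b j * z + h * z ^ 2\<close>: these give \<open>of_nat n\<close> and, as half of
  the difference of the two \<open>b\<close> sums, the second elementary symmetric function. The
  second-order term of the recursion subtracts the squares of \<open>a\<close>.\<close>

lemma coeff_2_rpoly_0_1:
  "coeff (rpoly a b h 0 1 (Suc n)) 2 = h ^ n / (\<Prod>j=1..n. a (int j)) *
     (of_nat n + ((\<Sum>j=1..n. b (int j))\<^sup>2 - (\<Sum>j=1..n. (b (int j))\<^sup>2) - 2 * (\<Sum>j=1..<n. (a (int j))\<^sup>2)) / (2 * h\<^sup>2))"
proof (induction n)
  case (Suc n)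
  define c where "c = h ^ n / (\<Prod>j=1..n. a (int j))"
  \<comment> \<open>At \<open>n = 0\<close> the solution itself is 0, so no square of
    \<open>a 0\<close> enters; this is why the sum starts at 1.\<close>
  define w where "w = (if n = 0 then 0 else (a (int n))\<^sup>2)"
  define S V W where "S = (\<Sum>j=1..n. b (int j))" and "V = (\<Sum>j=1..n. (b (int j))\<^sup>2)"
    and "W = (\<Sum>j=1..<n. (a (int j))\<^sup>2)"
  define X where "X = (S\<^sup>2 - V - 2 * W) / (2 * h\<^sup>2)"
  have c0: "a (int n) * coeff (rpoly a b h 0 1 n) 0 = c * w / h"
  proof (cases n)
    case (Suc m)
    then show ?thesis
      unfolding Suc coeff_0_rpoly_0_1 using nz by (simp add: c_def w_def Suc field_simps power2_eq_square)
  qed (simp add: w_def)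
  have W: "(\<Sum>j=1..<Suc n. (a (int j))\<^sup>2) = W + w"
    by (cases n) (auto simp: W_def w_def)
  have sums: "(\<Sum>j=1..Suc n. b (int j)) = S + b (int n + 1)"
    "(\<Sum>j=1..Suc n. (b (int j))\<^sup>2) = V + (b (int n + 1))\<^sup>2"
    "h ^ Suc n / (\<Prod>j=1..Suc n. a (int j)) = c * h / a (int n + 1)"
    by (simp_all add: c_def S_def V_def add.commute mult.commute)
  have X: "((S + b (int n + 1))\<^sup>2 - (V + (b (int n + 1))\<^sup>2) - 2 * (W + w)) / (2 * h\<^sup>2) = X + (S * b (int n + 1) - w) / h\<^sup>2"
    using nz(2) by (simp add: X_def field_simps power2_eq_square)
  have "coeff (rpoly a b h 0 1 (Suc (Suc n))) 2 =
    (h * coeff (rpoly a b h 0 1 (Suc n)) 2 - b (int n + 1) * coeff (rpoly a b h 0 1 (Suc n)) 1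
      + h * coeff (rpoly a b h 0 1 (Suc n)) 0 - a (int n) * coeff (rpoly a b h 0 1 n) 0) / a (int n + 1)"
    by (simp add: coeff_pCons numeral_2_eq_2)
  also have "\<dots> = (h * (c * (of_nat n + X)) - b (int n + 1) * (- c * (S / h)) + h * c - c * w / h) / a (int n + 1)"
    unfolding Suc coeff_0_rpoly_0_1 coeff_1_rpoly_0_1 c0 by (simp only: c_def S_def V_def W_def X_def)
  also have "\<dots> = c * h / a (int n + 1) * (of_nat (Suc n) + (X + (S * b (int n + 1) - w) / h\<^sup>2))"
  proof -
    have "h * (c * (of_nat n + X)) - b (int n + 1) * (- c * (S / h)) + h * c - c * w / h
        = c * h * (of_nat (Suc n) + (X + (S * b (int n + 1) - w) / h\<^sup>2))"
      using nz(2) by (simp add: field_simps power2_eq_square)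
    then show ?thesis by simp
  qed
  finally show ?case
    unfolding sums W X .
qed (simp add: numeral_2_eq_2)

text \<open>The \<open>theta\<close> part starts at order 2. There it supplies the square of
  \<open>a 0 = a q\<close> that the \<open>phi\<close> part lacks, which completes the sum over one
  period.\<close>

lemma coeff_rpoly_1_0:
  "coeff (rpoly a b h 1 0 (Suc n)) 0 = 0"
  "coeff (rpoly a b h 1 0 (Suc n)) 1 = 0"
  "coeff (rpoly a b h 1 0 (Suc (Suc n))) 2 = - a 0 * h ^ n / (\<Prod>j=1..Suc n. a (int j))"
proof -
  show 0: "coeff (rpoly a b h 1 0 (Suc n)) 0 = 0" for n
    by (induction n) (simp_all add: coeff_mult)
  show 1: "coeff (rpoly a b h 1 0 (Suc n)) 1 = 0" for n
    by (induction n) (use 0 in \<open>simp_all add: coeff_pCons\<close>)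
  show "coeff (rpoly a b h 1 0 (Suc (Suc n))) 2 = - a 0 * h ^ n / (\<Prod>j=1..Suc n. a (int j))"
  proof (induction n)
    case (Suc n)
    have "coeff (rpoly a b h 1 0 (Suc (Suc (Suc n)))) 2 =
      (h * coeff (rpoly a b h 1 0 (Suc (Suc n))) 2 - b (int (Suc n) + 1) * coeff (rpoly a b h 1 0 (Suc (Suc n))) 1
      + h * coeff (rpoly a b h 1 0 (Suc (Suc n))) 0 - a (int (Suc n)) * coeff (rpoly a b h 1 0 (Suc n)) 0) / a (int (Suc n) + 1)"
      by (subst rpoly.simps(3)) (simp add: coeff_pCons numeral_2_eq_2 del: rpoly.simps)
    then show ?case
      unfolding 0 1 Suc by (simp add: add.commute mult_ac)
  qed (simp add: coeff_pCons numeral_2_eq_2)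
qed

lemma coeff_rdiscr_poly:
  assumes q: "q \<ge> 2" and per: "a (int q) = a 0"
  defines "c \<equiv> h ^ q / (\<Prod>j=1..q. a (int j))"
  shows "coeff (rdiscr_poly a b h q) 0 = c"
    and "coeff (rdiscr_poly a b h q) 1 = - c * ((\<Sum>j=1..q. b (int j)) / h)"
    and "coeff (rdiscr_poly a b h q) 2 = c * (of_nat q + ((\<Sum>j=1..q. b (int j))\<^sup>2
           - (\<Sum>j=1..q. (b (int j))\<^sup>2) - 2 * (\<Sum>j=1..q. (a (int j))\<^sup>2)) / (2 * h\<^sup>2))"
proof -
  obtain n where n: "q = Suc (Suc n)"
    using q by (metis One_nat_def Suc_1 Suc_le_D le_Suc_ex plus_nat.simps(2))
  show "coeff (rdiscr_poly a b h q) 0 = c"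
    unfolding rdiscr_poly_def c_def using coeff_0_rpoly_0_1[of q] coeff_rpoly_1_0(1)[of "Suc n"]
    by (simp add: n del: rpoly.simps)
  show "coeff (rdiscr_poly a b h q) 1 = - c * ((\<Sum>j=1..q. b (int j)) / h)"
    unfolding rdiscr_poly_def c_def using coeff_1_rpoly_0_1[of q] coeff_rpoly_1_0(2)[of "Suc n"]
    by (simp add: n del: rpoly.simps)
  have A: "(\<Sum>j=1..q. (a (int j))\<^sup>2) = (\<Sum>j=1..<q. (a (int j))\<^sup>2) + (a 0)\<^sup>2"
    using per by (simp add: n atLeastLessThanSuc_atLeastAtMost)
  have "(\<Prod>j=1..q. a (int j)) = (\<Prod>j=1..Suc n. a (int j)) * a 0"
    using per by (simp add: n)
  then have "coeff (rpoly a b h 1 0 q) 2 = c * (- (a 0)\<^sup>2 / h\<^sup>2)"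
    unfolding c_def n coeff_rpoly_1_0(3) using nz by (simp add: field_simps power2_eq_square)
  then show "coeff (rdiscr_poly a b h q) 2 = c * (of_nat q + ((\<Sum>j=1..q. b (int j))\<^sup>2
           - (\<Sum>j=1..q. (b (int j))\<^sup>2) - 2 * (\<Sum>j=1..q. (a (int j))\<^sup>2)) / (2 * h\<^sup>2))"
    unfolding A rdiscr_poly_def using coeff_2_rpoly_0_1[of q] nz
    by (simp add: c_def del: rpoly.simps) (simp add: field_simps)
qed

end

section \<open>The trace formula and the case of equality\<close>

text \<open>\<open>L\<close> is Hermitian, so the trace is the sum of the squared moduli of its
  entries. For \<open>q = 2\<close> the corner merges with the off-diagonal entry, and the modulus
  of \<open>a 1 + \<i> * a 2\<close> squared still splits into the two squares.\<close>

lemma trace_L2_eq: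
  assumes "q \<ge> 2"
  shows "trace_L2 a b q = of_real ((\<Sum>j=1..q. (b (int j))\<^sup>2) + 2 * (\<Sum>j=1..q. (a (int j))\<^sup>2))"
proof (cases "q = 2")
  case True
  show ?thesis
    unfolding trace_L2_def True
    by (simp add: numeral_2_eq_2 Lmat_def complex_eq_iff power2_eq_square algebra_simps)
next
  case False
  then obtain n where n: "q = Suc n" "n \<ge> 2"
    using assms by (cases q) auto
  \<comment> \<open>Diagonal, two off-diagonals and two corners are disjoint for
    \<open>q \<ge> 3\<close>, so the indicator terms may be added.\<close>
  have entry: "Lmat a b q j k * Lmat a b q k j = of_real
      ((if k = j then (b (int j))\<^sup>2 else 0) + (if k = Suc j then (a (int j))\<^sup>2 else 0)
       + (if j = Suc k then (a (int k))\<^sup>2 else 0)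
       + (if j = 1 then if k = q then (a (int q))\<^sup>2 else 0 else 0)
       + (if k = 1 then if j = q then (a (int q))\<^sup>2 else 0 else 0))"
    if "j \<in> {1..q}" "k \<in> {1..q}" for j k
  proof -
    have q: "q \<noteq> 2" "q \<noteq> 1" "q - 1 = n" "1 < q" using n by auto
    consider "k = j" | "k = Suc j" | "j = Suc k" | "j = 1" "k = q" | "k = 1" "j = q"
      | "k \<noteq> j" "k \<noteq> Suc j" "j \<noteq> Suc k" "\<not> (j = 1 \<and> k = q)" "\<not> (k = 1 \<and> j = q)"
      by blast
    then show ?thesis
    proof cases
      case 6
      then have "Lmat a b q j k = 0"
        using q by (auto simp: Lmat_def)
      with 6 show ?thesis by auto
    qed (use that n q in \<open>simp_all add: Lmat_def power2_eq_square complex_eq_iff\<close>)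
  qed
  have "trace_L2 a b q = of_real (\<Sum>j=1..q. \<Sum>k=1..q.
      ((if k = j then (b (int j))\<^sup>2 else 0) + (if k = Suc j then (a (int j))\<^sup>2 else 0)
       + (if j = Suc k then (a (int k))\<^sup>2 else 0)
       + (if j = 1 then if k = q then (a (int q))\<^sup>2 else 0 else 0)
       + (if k = 1 then if j = q then (a (int q))\<^sup>2 else 0 else 0)))"
    unfolding trace_L2_def of_real_sum by (intro sum.cong refl entry)
  also have "\<dots> = of_real ((\<Sum>j=1..q. (b (int j))\<^sup>2) + (\<Sum>j=1..n. (a (int j))\<^sup>2)
      + (\<Sum>j=1..n. (a (int j))\<^sup>2) + (a (int q))\<^sup>2 + (a (int q))\<^sup>2)"
  proof -
    have above: "(\<Sum>j=1..q. \<Sum>k=1..q. if k = Suc j then (a (int j))\<^sup>2 else 0) = (\<Sum>j=1..n. (a (int j))\<^sup>2)"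
    proof -
      have "(\<Sum>j=1..q. \<Sum>k=1..q. if k = Suc j then (a (int j))\<^sup>2 else 0) = (\<Sum>j=1..q. if Suc j \<le> q then (a (int j))\<^sup>2 else 0)"
        by simp
      also have "\<dots> = (\<Sum>j=1..n. (a (int j))\<^sup>2)"
        by (rule sum.mono_neutral_cong_right) (auto simp: n)
      finally show ?thesis .
    qed
    then have below: "(\<Sum>j=1..q. \<Sum>k=1..q. if j = Suc k then (a (int k))\<^sup>2 else 0) = (\<Sum>j=1..n. (a (int j))\<^sup>2)"
      by (subst sum.swap)
    have "(\<Sum>k=1..q. if j = 1 then if k = q then (a (int q))\<^sup>2 else 0 else 0) = (if j = 1 then (a (int q))\<^sup>2 else 0)" for j :: nat
      using n by (cases "j = 1") simp_all
    then have right: "(\<Sum>j=1..q. \<Sum>k=1..q. if j = 1 then if k = q then (a (int q))\<^sup>2 else 0 else 0) = (a (int q))\<^sup>2"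
      using n by (simp only: sum.delta finite_atLeastAtMost) simp
    then have left: "(\<Sum>j=1..q. \<Sum>k=1..q. if k = 1 then if j = q then (a (int q))\<^sup>2 else 0 else 0) = (a (int q))\<^sup>2"
      by (subst sum.swap)
    have "(\<Sum>j=1..q. \<Sum>k=1..q. if k = j then (b (int j))\<^sup>2 else 0) = (\<Sum>j=1..q. (b (int j))\<^sup>2)"
      by simp
    then show ?thesis
      by (simp only: sum.distrib above below left right)
  qed
  finally show ?thesis
    by (simp add: n)
qed

text \<open>The case of equality in AM-GM. With \<open>x j = (a j / A) ^ 2\<close> the logarithms
  sum to 0, so the nonnegative terms \<open>x j - 1 - ln (x j)\<close> have sum at most 0; each is
  0, which forces \<open>x j = 1\<close>.\<close>

lemma sum_squares_eq_geo_mean_imp_constant: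
  assumes q: "q \<ge> 1" and apos: "\<forall>n. a n > 0"
    and le: "(\<Sum>j=1..q. (a (int j))\<^sup>2) \<le> real q * (geo_mean a q)\<^sup>2"
  shows "\<forall>j\<in>{1..q}. a (int j) = geo_mean a q"
proof -
  let ?A = "geo_mean a q"
  have prod: "(\<Prod>j=1..q. a (int j)) > 0"
    by (intro prod_pos) (use apos in auto)
  have anz: "a n \<noteq> 0" for n
    using apos by (metis less_irrefl)
  have A: "?A > 0" by (simp add: geo_mean_def anz)
  have "ln (\<Prod>j=1..q. a (int j)) = (\<Sum>j=1..q. ln (a (int j)))"
    using apos by (intro ln_prod) (auto simp: less_imp_neq[symmetric])
  then have lnA: "real q * ln ?A = (\<Sum>j=1..q. ln (a (int j)))"
    using q prod by (simp add: geo_mean_def ln_powr)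
  define x where "x j = (a (int j) / ?A)\<^sup>2" for j :: nat
  have x: "x j > 0" for j using A by (simp add: x_def anz)
  have "(\<Sum>j=1..q. x j - 1 - ln (x j)) = (\<Sum>j=1..q. (a (int j))\<^sup>2) / ?A\<^sup>2 - real q
      - 2 * ((\<Sum>j=1..q. ln (a (int j))) - real q * ln ?A)"
    using apos A by (simp add: x_def anz power_divide sum_subtractf sum_divide_distrib ln_div ln_realpow
        sum_distrib_left right_diff_distrib)
  also have "\<dots> \<le> 0"
    using le A by (simp add: lnA field_simps)
  finally have "(\<Sum>j=1..q. x j - 1 - ln (x j)) \<le> 0" .
  moreover have nn: "0 \<le> x j - 1 - ln (x j)" for j
    using ln_le_minus_one[OF x[of j]] by simp
  ultimately have "(\<Sum>j=1..q. x j - 1 - ln (x j)) = 0"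
    by (intro antisym sum_nonneg) auto
  then have "\<forall>j\<in>{1..q}. x j - 1 - ln (x j) = 0"
    using nn by (subst (asm) sum_nonneg_eq_0_iff) auto
  then have "\<forall>j\<in>{1..q}. x j = 1"
    using ln_eq_minus_one[OF x] by simp
  show ?thesis
  proof
    fix j assume "j \<in> {1..q}"
    with \<open>\<forall>j\<in>{1..q}. x j = 1\<close> have "a (int j) / ?A = 1 \<or> a (int j) / ?A = - 1"
      by (simp add: x_def power2_eq_1_iff)
    moreover have "a (int j) / ?A > 0"
      using A apos by simp
    ultimately show "a (int j) = ?A"
      using A by auto
  qed
qed

text \<open>A nonreal \<open>z\<close> would give \<open>y = 2 * Re z\<close> and thus modulus 1.
  For real \<open>z\<close> the bound is \<open>(1 - \<bar>z\<bar>) ^ 2 > 0\<close> divided by the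
  modulus of \<open>z\<close>.\<close>

lemma joukowski_real_value:
  assumes z: "norm z < 1" "z \<noteq> 0" and y: "z + 1 / z = complex_of_real y"
  shows "\<bar>y\<bar> > 2"
proof -
  have "z * z + 1 = of_real y * z"
    using y z by (simp add: field_simps)
  then have re: "Re z * Re z - Im z * Im z + 1 = y * Re z" and im: "2 * Re z * Im z = y * Im z"
    by (simp_all add: complex_eq_iff algebra_simps)
  have "(norm z)\<^sup>2 < 1"
    using z by (simp add: abs_square_less_1)
  then have lt: "Re z * Re z + Im z * Im z < 1"
    unfolding cmod_power2 by (simp add: power2_eq_square)
  have "Im z = 0"
  proof (rule ccontr)
    assume "Im z \<noteq> 0"
    then have "y = 2 * Re z" using im by simp
    then show False using re lt by simp
  qed
  then have "Re z \<noteq> 0" "\<bar>Re z\<bar> < 1"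
    using z by (auto simp: complex_eq_iff norm_complex_def)
  then have "0 < (1 - \<bar>Re z\<bar>) * (1 - \<bar>Re z\<bar>)"
    by simp
  then have "2 * \<bar>Re z\<bar> < Re z * Re z + 1"
    by (simp add: algebra_simps)
  also have "\<dots> = \<bar>y\<bar> * \<bar>Re z\<bar>"
    using re \<open>Im z = 0\<close> by (simp add: abs_mult[symmetric] flip: re)
  finally show ?thesis
    using \<open>Re z \<noteq> 0\<close> by simp
qed

lemma periodic_eq_const:
  fixes f :: "int \<Rightarrow> 'a"
  assumes q: "q \<ge> 1" and per: "\<forall>n. f (n + int q) = f n" and c: "\<forall>j\<in>{1..q}. f (int j) = c"
  shows "f n = c"
proof -
  have shift: "f (m + int k * int q) = f m" for m k
  proof (induction k)
    case (Suc k)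
    then show ?case
      using per[rule_format, of "m + int k * int q"] by (simp add: algebra_simps)
  qed simp
  \<comment> \<open>The shift by 1 puts the representative in \<open>{1..q}\<close> instead of
    \<open>{0..<q}\<close>.\<close>
  define j where "j = nat ((n - 1) mod int q) + 1"
  have m: "0 \<le> (n - 1) mod int q" "(n - 1) mod int q < int q"
    using q by auto
  then have "j \<in> {1..q}"
    by (auto simp: j_def nat_less_iff Suc_le_eq)
  then have "f (int j) = c"
    using c by blast
  moreover have "n = int j + ((n - 1) div int q) * int q"
    using m by (simp add: j_def)
  moreover have "f (int j + d * int q) = f (int j)" for d
  proof (cases "d \<ge> 0")
    case True
    then show ?thesis using shift[of "int j" "nat d"] by simp
  next
    case False
    then show ?thesis using shift[of "int j + d * int q" "nat (- d)"] by simp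
  qed
  ultimately show ?thesis by metis
qed

section \<open>Deduction of both inequalities from the coefficient bounds\<close>

theorem theorem1:
  fixes a b :: "int \<Rightarrow> real" and q :: nat
  assumes "q \<ge> 2"
    and "\<forall>n. a n > 0"
    and "min_common_period a b q"
    and "normalised a b q"
  shows "half_width a b q > 2 * geo_mean a q \<and>
         trace_L2 a b q = complex_of_real (Re (trace_L2 a b q)) \<and>
         (half_width a b q)\<^sup>2 * (1/2 + ln (half_width a b q / (2 * geo_mean a q)))
           > Re (trace_L2 a b q) / real q"
proof -
  have per: "\<forall>n. a (n + int q) = a n" "\<forall>n. b (n + int q) = b n"
    using assms(3) by (auto simp: min_common_period_def)
  have aq: "a (int q) = a 0"
    using per(1)[rule_format, of 0] by simp
  have anz: "a n \<noteq> 0" for n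
    using assms(2) by (metis less_irrefl)
  define S V W where "S = (\<Sum>j=1..q. b (int j))" and "V = (\<Sum>j=1..q. (b (int j))\<^sup>2)"
    and "W = (\<Sum>j=1..q. (a (int j))\<^sup>2)"
  define h A where "h = half_width a b q / 2" and "A = geo_mean a q"
  note bounds = jspec_bounds[OF assms(2) aq assms(1,4)]
  have h: "h > 0" "half_width a b q = 2 * h"
    using bounds(1) by (simp_all add: h_def)
  have prod: "(\<Prod>j=1..q. a (int j)) > 0"
    by (intro prod_pos) (use assms(2) in auto)
  have A: "A > 0" by (simp add: A_def geo_mean_def anz)
  have "A ^ q = A powr real q"
    using A by (simp add: powr_realpow)
  also have "\<dots> = (\<Prod>j=1..q. a (int j))"
    using prod assms(1) by (simp add: A_def geo_mean_def powr_powr)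
  finally have c0: "h ^ q / (\<Prod>j=1..q. a (int j)) = (h / A) ^ q"
    by (simp add: power_divide)
  define a' b' where "a' = (\<lambda>n. complex_of_real (a n))" and "b' = (\<lambda>n. complex_of_real (b n))"
  define P where "P = rdiscr_poly a' b' (of_real h) q"
  have coeffP: "coeff P 0 = of_real ((h / A) ^ q)"
    "coeff P 1 = of_real (- ((h / A) ^ q) * (S / h))"
    "coeff P 2 = of_real ((h / A) ^ q * (real q + (S\<^sup>2 - V - 2 * W) / (2 * h\<^sup>2)))"
  proof -
    have nz: "\<forall>n. a' n \<noteq> 0" "complex_of_real h \<noteq> 0" and per': "a' (int q) = a' 0"
      using h anz aq by (simp_all add: a'_def)
    have c: "complex_of_real h ^ q / (\<Prod>j=1..q. a' (int j)) = of_real ((h / A) ^ q)"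
      unfolding c0[symmetric] by (simp add: a'_def)
    have sums: "(\<Sum>j=1..q. b' (int j)) = of_real S" "(\<Sum>j=1..q. (b' (int j))\<^sup>2) = of_real V"
      "(\<Sum>j=1..q. (a' (int j))\<^sup>2) = of_real W"
      by (simp_all add: S_def V_def W_def a'_def b'_def)
    note coeffs = coeff_rdiscr_poly[OF nz assms(1) per', of b', unfolded sums c, folded P_def]
    show "coeff P 0 = of_real ((h / A) ^ q)"
      "coeff P 1 = of_real (- ((h / A) ^ q) * (S / h))"
      "coeff P 2 = of_real ((h / A) ^ q * (real q + (S\<^sup>2 - V - 2 * W) / (2 * h\<^sup>2)))"
      unfolding coeffs by simp_all
  qed
  \<comment> \<open>A value in [-2, 2] would make \<open>l\<close> a real point of the spectrum, so
    \<open>\<bar>l\<bar> \<le> 2 * h\<close>, whereas the Joukowski map sends the punctured disc off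
    \<open>[-2 * h, 2 * h]\<close>.\<close>
  have avoid: "poly P z \<noteq> z ^ q * of_real t" if z: "norm z < 1" "z \<noteq> 0" and t: "\<bar>t\<bar> \<le> 2" for z t
  proof
    assume eq: "poly P z = z ^ q * of_real t"
    define l where "l = of_real h * (z + 1 / z)"
    have l: "poly (discr_poly a' b' q) l = of_real t"
      using eq poly_rdiscr_poly[OF z(2), of a' b' "of_real h" q] z by (simp add: P_def l_def)
    then have "Im l = 0"
      using discr_poly_real_value_imp_real[OF assms(2) aq assms(1) _ t, of b l] by (simp add: a'_def b'_def)
    then have Rel: "l = of_real (Re l)"
      by (simp add: complex_eq_iff)
    then have "complex_of_real (discr a b q (Re l)) = of_real t"
      using l poly_discr_poly_of_real[of a b q "Re l"] by (simp add: a'_def b'_def)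
    then have "Re l \<in> jspec a b q"
      using t by (simp add: jspec_def)
    then have "\<bar>Re l\<bar> \<le> 2 * h"
      using bounds(2) h by auto
    moreover have "z + 1 / z = of_real (Re l / h)"
      using Rel h by (simp add: l_def field_simps)
    then have "\<bar>Re l / h\<bar> > 2"
      by (rule joukowski_real_value[OF z])
    ultimately show False
      using h by (simp add: field_simps)
  qed
  have P0: "coeff P 0 \<noteq> 0"
    using h A by (simp add: coeffP)
  obtain f M where f: "f holomorphic_on ball 0 1"
      "\<And>z. \<lbrakk>norm z < 1; z \<noteq> 0\<rbrakk> \<Longrightarrow> real q * ln (norm z) \<le> Re (f z)"
      "\<And>z. norm z < 1 \<Longrightarrow> Re (f z) \<le> M"
    and f0: "Re (f 0) = ln (norm (coeff P 0))"
    and f2: "(deriv ^^ 2) f 0 / 2 = coeff P 2 / coeff P 0 - (coeff P 1 / coeff P 0)\<^sup>2 / 2"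
  proof (rule holomorphic_log_zero_free_poly[of q P, OF assms(1) _ P0])
    show "poly P z \<noteq> z ^ q * of_real t" if "norm z < 1" "z \<noteq> 0" "\<bar>t\<bar> \<le> 2" for z t
      using that by (rule avoid)
  qed blast
  have Re_f0: "Re (f 0) = real q * ln (h / A)"
    using h A by (simp add: f0 coeffP norm_power norm_divide ln_realpow)
  \<comment> \<open>The square of \<open>S\<close> in the second coefficient cancels against the
    square of the first, which leaves the trace \<open>V + 2 * W\<close>.\<close>
  have "(deriv ^^ 2) f 0 / 2 = of_real (real q - (V + 2 * W) / (2 * h\<^sup>2))"
  proof -
    have "(h / A) ^ q \<noteq> 0" using h A by simp
    then have val: "(h / A) ^ q * (real q + (S\<^sup>2 - V - 2 * W) / (2 * h\<^sup>2)) / (h / A) ^ q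
       - (- ((h / A) ^ q) * (S / h) / (h / A) ^ q)\<^sup>2 / 2 = real q - (V + 2 * W) / (2 * h\<^sup>2)"
      using h A by (simp add: power2_eq_square field_simps)
    show ?thesis
      unfolding f2 coeffP val[symmetric] by (simp only: of_real_divide of_real_power of_real_diff of_real_numeral)
  qed
  then have Re_f2: "Re ((deriv ^^ 2) f 0) / 2 = real q - (V + 2 * W) / (2 * h\<^sup>2)"
    by (metis Re_complex_of_real Re_divide_numeral)
  note ineq = coefficient_bounds_of_bounded_Re[OF f, unfolded Re_f0 Re_f2]
  \<comment> \<open>At \<open>h = A\<close> the logarithm vanishes and \<open>ineq(2)\<close> bounds
    the trace by \<open>2 * q * A ^ 2\<close>; equality in AM-GM then yields period 1.\<close>
  have "h \<noteq> A"
  proof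
    assume "h = A"
    then have "V + 2 * W \<le> 2 * (real q * A\<^sup>2)"
      using ineq(2) A by (simp add: field_simps)
    moreover have V0: "V \<ge> 0"
      by (simp add: V_def sum_nonneg)
    ultimately have "(\<Sum>j=1..q. (a (int j))\<^sup>2) \<le> real q * (geo_mean a q)\<^sup>2"
      by (simp add: W_def A_def)
    then have const: "\<forall>j\<in>{1..q}. a (int j) = A"
      using sum_squares_eq_geo_mean_imp_constant[of q a] assms(1,2) by (simp add: A_def)
    then have "W = real q * A\<^sup>2"
      by (simp add: W_def)
    with \<open>V + 2 * W \<le> _\<close> V0 have "V = 0" by simp
    then have "\<forall>j\<in>{1..q}. b (int j) = 0"
      unfolding V_def by (subst (asm) sum_nonneg_eq_0_iff) auto
    then have b: "b n = 0" for n
      using assms(1) by (intro periodic_eq_const[OF _ per(2)]) auto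
    have a: "a n = A" for n
      using assms(1) by (intro periodic_eq_const[OF _ per(1) const]) auto
    have "\<forall>n. a (n + int 1) = a n \<and> b (n + int 1) = b n"
      by (simp add: a b)
    moreover have "1 \<le> (1::nat) \<and> 1 < q"
      using assms(1) by simp
    ultimately show False
      using assms(3) unfolding min_common_period_def by blast
  qed
  moreover have "0 \<le> ln (h / A)"
    using ineq(1) assms(1) by (simp add: zero_le_mult_iff)
  ultimately have "h > A"
    using h A by simp
  then have "ln (h / A) > 0"
    using A by simp
  \<comment> \<open>Equality would by \<open>ineq(3)\<close> force
    \<open>q * ln (h / A) = 0\<close>.\<close>
  then have "0 < 2 * (real q * ln (h / A)) + (real q - (V + 2 * W) / (2 * h\<^sup>2))"
    using ineq(2,3) assms(1) by (cases "2 * (real q * ln (h / A)) + (real q - (V + 2 * W) / (2 * h\<^sup>2)) = 0") auto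
  \<comment> \<open>Multiplication by \<open>2 * h ^ 2 / q\<close>; with \<open>c = 2 * h\<close>
    the argument \<open>h / A\<close> is \<open>c / (2 * A)\<close>.\<close>
  then have "(V + 2 * W) / real q < (2 * h)\<^sup>2 * (1 / 2 + ln (h / A))"
    using h assms(1) by (simp add: field_simps power2_eq_square)
  then show ?thesis
    using \<open>h > A\<close> unfolding trace_L2_eq[OF assms(1)] h(2) by (simp add: V_def W_def A_def)
qed

end
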